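(* Let $\mathcal{M}_{\pm}$ be a quantum Markov category, $\mathcal{M}$ its subcategory of even morphisms, and $\mathcal{C}$ a subcategory of $\mathcal{M}$. Let $p:I\to X$, $q:I\to Y$, $r:I\to Z$ be states in $\mathcal{C}$ and let $f:X\to Y$ and $g:Y\to Z$ be state-preserving morphisms in $\mathcal{C}$, so that $q=f\circ p$ and $r=g\circ q$. 1. If $\overline f:Y\to X$ and $\overline g:Z\to Y$ are left (respectively, right) Bayes maps in $\mathcal{M}$ for $(f,p,q)$ and $(g,q,r)$, respectively, then $\overline f\circ\overline g$ is a left (respectively, right) Bayes map for $(g\circ f,p,r)$. 2. If $\mathcal{C}$ is also $*$-preserving and $\overline f$ is a Bayesian inverse of $(f,p,q)$ (so $\overline f$ is in $\mathcal{C}$), then $f$ is a Bayesian inverse of $(\overline f,q,p)$.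
   Context: A $\mathbb{Z}_2$-monoidal category is a category in which every morphism has a grade in $\mathbb{Z}_2=\{0,1\}$ ($0$ = even, $1$ = odd), identities being even and grades adding under composition, such that for each object $X$ and each grade there is an isomorphism with source $X$ of that grade; together with a tensor product assigning $X\otimes Y$ to objects and $f\otimes f'$ (of the common grade) to pairs of morphisms of equal grade, functorially; a unit object $I$ with a chosen odd involution $*_I$ of $I$; and even natural isomorphisms (associator, symmetry $c_{X,Y}:X\otimes Y\to Y\otimes X$, unitor $I\otimes X\to X$) satisfying the usual axioms of a symmetric monoidal category. Associators and unitors are suppressed. A quantum CD category is a $\mathbb{Z}_2$-monoidal category with, for each object $X$, even morphisms $\Delta_X:X\to X\otimes X$, $!_X:X\to I$ and an odd morphism $*_X:X\to X$ such that: $(!_X\otimes\mathrm{id})\Delta_X=\mathrm{id}_X=(\mathrm{id}\otimes{!_X})\Delta_X$; $(\Delta_X\otimes\mathrm{id})\Delta_X=(\mathrm{id}\otimes\Delta_X)\Delta_X$; $c_{X,X}( *_X\otimes*_X)\Delta_X=\Delta_X*_X$; $!_{X\otimes Y}={!_X}\otimes{!_Y}$; $!_I=\mathrm{id}_I$; $\Delta_{X\otimes Y}=(\mathrm{id}_X\otimes c_{X,Y}\otimes\mathrm{id}_Y)(\Delta_X\otimes\Delta_Y)$; $\Delta_I=\mathrm{id}_I$; $*_X*_X=\mathrm{id}_X$; $*_{X\otimes Y}=*_X\otimes*_Y$; $!_X*_X=*_I\,!_X$. It is a quantum Markov category if moreover every even $f:X\to Y$ satisfies $!_Y f={!_X}$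 and every odd $f:X\to Y$ satisfies $!_Yf={!_X}*_X$. A morphism $f:X\to Y$ is $*$-preserving if $f*_X=*_Yf$; a subcategory is $*$-preserving if all its morphisms are. A state on $X$ is a morphism $I\to X$. Given states $p:I\to X$, $q:I\to Y$ and $f:X\to Y$ with $fp=q$, a left Bayes map for $(f,p,q)$ is an even morphism $g:Y\to X$ with $(g\otimes\mathrm{id}_Y)\Delta_Yq=(\mathrm{id}_X\otimes f)\Delta_Xp$; a right Bayes map is an even $g:Y\to X$ with $(\mathrm{id}_Y\otimes g)\Delta_Yq=(f\otimes\mathrm{id}_X)\Delta_Xp$. A left/right Bayesian inverse in $\mathcal{C}$ is a left/right Bayes map that lies in $\mathcal{C}$. When $\mathcal{C}$ is $*$-preserving the left and right notions of Bayesian inverse coincide and the adjective is dropped. *)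

theory Defs
  imports "HOL-Library.Z2"
begin

section \<open>Categories\<close>

record ('o, 'm) category_data =
  Obj :: "'o set"
  Arr :: "'m set"
  Dom :: "'m \<Rightarrow> 'o"
  Cod :: "'m \<Rightarrow> 'o"
  Ident :: "'o \<Rightarrow> 'm"
  Comp :: "'m \<Rightarrow> 'm \<Rightarrow> 'm"  (infixl \<open>\<cdot>\<index>\<close> 65)

definition hom :: "('o, 'm, 'e) category_data_scheme \<Rightarrow> 'o \<Rightarrow> 'o \<Rightarrow> 'm set" where
  "hom C X Y = {f \<in> Arr C. Dom C f = X \<and> Cod C f = Y}"

locale category =
  fixes C :: "('o, 'm, 'e) category_data_scheme" (structure)
  assumes dom_obj: "f \<in> Arr C \<Longrightarrow> Dom C f \<in> Obj C"
    and cod_obj: "f \<in> Arr C \<Longrightarrow> Cod C f \<in> Obj C"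
    and id_hom: "X \<in> Obj C \<Longrightarrow> Ident C X \<in> hom C X X"
    and comp_hom: "\<lbrakk>f \<in> hom C X Y; g \<in> hom C Y Z\<rbrakk> \<Longrightarrow> g \<cdot> f \<in> hom C X Z"
    and id_left: "f \<in> hom C X Y \<Longrightarrow> Ident C Y \<cdot> f = f"
    and id_right: "f \<in> hom C X Y \<Longrightarrow> f \<cdot> Ident C X = f"
    and comp_assoc: "\<lbrakk>f \<in> hom C W X; g \<in> hom C X Y; h \<in> hom C Y Z\<rbrakk>
      \<Longrightarrow> (h \<cdot> g) \<cdot> f = h \<cdot> (g \<cdot> f)"

definition inverse_arrows ::
    "('o, 'm, 'e) category_data_scheme \<Rightarrow> 'm \<Rightarrow> 'm \<Rightarrow> bool" where
  "inverse_arrows C f g \<longleftrightarrow> f \<in> Arr C \<and> g \<in> hom C (Cod C f) (Dom C f) \<and>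
     g \<cdot>\<^bsub>C\<^esub> f = Ident C (Dom C f) \<and> f \<cdot>\<^bsub>C\<^esub> g = Ident C (Cod C f)"

definition iso :: "('o, 'm, 'e) category_data_scheme \<Rightarrow> 'm \<Rightarrow> bool" where
  "iso C f \<longleftrightarrow> (\<exists>g. inverse_arrows C f g)"

definition inverse_arrow :: "('o, 'm, 'e) category_data_scheme \<Rightarrow> 'm \<Rightarrow> 'm" where
  "inverse_arrow C f = (THE g. inverse_arrows C f g)"

definition subcategory ::
    "('o, 'm, 'd) category_data_scheme \<Rightarrow> ('o, 'm, 'e) category_data_scheme \<Rightarrow> bool" where
  "subcategory C D \<longleftrightarrow> category C \<and> category D \<and>
     Obj C \<subseteq> Obj D \<and> Arr C \<subseteq> Arr D \<and>
     (\<forall>f \<in> Arr C. Dom C f = Dom D f \<and> Cod C f = Cod D f) \<and>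
     (\<forall>X \<in> Obj C. Ident C X = Ident D X) \<and>
     (\<forall>f \<in> Arr C. \<forall>g \<in> Arr C. Cod C f = Dom C g \<longrightarrow> g \<cdot>\<^bsub>C\<^esub> f = g \<cdot>\<^bsub>D\<^esub> f)"


section \<open>\<open>\<int>\<^sub>2\<close>-monoidal categories\<close>

record ('o, 'm) graded_data = "('o, 'm) category_data" +
  grade :: "'m \<Rightarrow> bit"

locale z2_graded_category = category M
  for M :: "('o, 'm, 'e) graded_data_scheme" (structure) +
  assumes grade_id: "X \<in> Obj M \<Longrightarrow> grade M (Ident M X) = 0"
    and grade_comp: "\<lbrakk>f \<in> hom M X Y; g \<in> hom M Y Z\<rbrakk>
      \<Longrightarrow> grade M (g \<cdot> f) = grade M g + grade M f"
    and grade_iso: "X \<in> Obj M \<Longrightarrow> \<exists>f. iso M f \<and> Dom M f = X \<and> grade M f = d"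

definition even_subcategory ::
    "('o, 'm, 'e) graded_data_scheme \<Rightarrow> ('o, 'm) category_data" where
  "even_subcategory M = \<lparr>Obj = Obj M, Arr = {f \<in> Arr M. grade M f = 0},
     Dom = Dom M, Cod = Cod M, Ident = Ident M, Comp = Comp M\<rparr>"

text \<open>
  \<open>tensor_arr M f f'\<close> is meaningful only for \<open>f\<close>, \<open>f'\<close> of equal grade: all laws below are
  restricted to such pairs.
\<close>

record ('o, 'm) monoidal_data = "('o, 'm) graded_data" +
  tensor_obj :: "'o \<Rightarrow> 'o \<Rightarrow> 'o"  (infixr \<open>\<otimes>\<^sub>o\<index>\<close> 70)
  tensor_arr :: "'m \<Rightarrow> 'm \<Rightarrow> 'm"  (infixr \<open>\<otimes>\<index>\<close> 70)
  unit :: 'o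
  unit_star :: 'm
  assoc :: "'o \<Rightarrow> 'o \<Rightarrow> 'o \<Rightarrow> 'm"
  symm :: "'o \<Rightarrow> 'o \<Rightarrow> 'm"
  lunit :: "'o \<Rightarrow> 'm"

definition runit :: "('o, 'm, 'e) monoidal_data_scheme \<Rightarrow> 'o \<Rightarrow> 'm" where
  "runit M X = lunit M X \<cdot>\<^bsub>M\<^esub> symm M X (unit M)"

text \<open>
  The odd involution \<open>unit_star\<close> makes the unit a functor from the one-object category
  \<open>\<int>\<^sub>2\<close>; accordingly, naturality of the unitor pairs an odd morphism with \<open>unit_star\<close>.
\<close>

locale z2_monoidal_category = z2_graded_category M
  for M :: "('o, 'm, 'e) monoidal_data_scheme" (structure) +
  assumes tensor_obj: "\<lbrakk>X \<in> Obj M; Y \<in> Obj M\<rbrakk> \<Longrightarrow> X \<otimes>\<^sub>o Y \<in> Obj M"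
    and tensor_hom: "\<lbrakk>f \<in> hom M X Y; f' \<in> hom M X' Y'; grade M f = grade M f'\<rbrakk>
      \<Longrightarrow> f \<otimes> f' \<in> hom M (X \<otimes>\<^sub>o X') (Y \<otimes>\<^sub>o Y')"
    and tensor_grade: "\<lbrakk>f \<in> Arr M; f' \<in> Arr M; grade M f = grade M f'\<rbrakk>
      \<Longrightarrow> grade M (f \<otimes> f') = grade M f"
    and tensor_id: "\<lbrakk>X \<in> Obj M; Y \<in> Obj M\<rbrakk> \<Longrightarrow> Ident M X \<otimes> Ident M Y = Ident M (X \<otimes>\<^sub>o Y)"
    and tensor_comp: "\<lbrakk>f \<in> hom M X Y; g \<in> hom M Y Z; f' \<in> hom M X' Y'; g' \<in> hom M Y' Z';
        grade M f = grade M f'; grade M g = grade M g'\<rbrakk>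
      \<Longrightarrow> (g \<cdot> f) \<otimes> (g' \<cdot> f') = (g \<otimes> g') \<cdot> (f \<otimes> f')"
    and unit_obj: "unit M \<in> Obj M"
    and unit_star_hom: "unit_star M \<in> hom M (unit M) (unit M)"
    and unit_star_odd: "grade M (unit_star M) = 1"
    and unit_star_involution: "unit_star M \<cdot> unit_star M = Ident M (unit M)"

    and assoc_hom: "\<lbrakk>X \<in> Obj M; Y \<in> Obj M; Z \<in> Obj M\<rbrakk>
      \<Longrightarrow> assoc M X Y Z \<in> hom M ((X \<otimes>\<^sub>o Y) \<otimes>\<^sub>o Z) (X \<otimes>\<^sub>o (Y \<otimes>\<^sub>o Z))"
    and assoc_even: "\<lbrakk>X \<in> Obj M; Y \<in> Obj M; Z \<in> Obj M\<rbrakk> \<Longrightarrow> grade M (assoc M X Y Z) = 0"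
    and assoc_iso: "\<lbrakk>X \<in> Obj M; Y \<in> Obj M; Z \<in> Obj M\<rbrakk> \<Longrightarrow> iso M (assoc M X Y Z)"
    and assoc_natural: "\<lbrakk>f \<in> hom M X X'; g \<in> hom M Y Y'; h \<in> hom M Z Z';
        grade M f = grade M g; grade M g = grade M h\<rbrakk>
      \<Longrightarrow> assoc M X' Y' Z' \<cdot> ((f \<otimes> g) \<otimes> h) = (f \<otimes> (g \<otimes> h)) \<cdot> assoc M X Y Z"

    and sym_hom: "\<lbrakk>X \<in> Obj M; Y \<in> Obj M\<rbrakk> \<Longrightarrow> symm M X Y \<in> hom M (X \<otimes>\<^sub>o Y) (Y \<otimes>\<^sub>o X)"
    and sym_even: "\<lbrakk>X \<in> Obj M; Y \<in> Obj M\<rbrakk> \<Longrightarrow> grade M (symm M X Y) = 0"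
    and sym_natural: "\<lbrakk>f \<in> hom M X X'; g \<in> hom M Y Y'; grade M f = grade M g\<rbrakk>
      \<Longrightarrow> symm M X' Y' \<cdot> (f \<otimes> g) = (g \<otimes> f) \<cdot> symm M X Y"
    and sym_sym: "\<lbrakk>X \<in> Obj M; Y \<in> Obj M\<rbrakk> \<Longrightarrow> symm M Y X \<cdot> symm M X Y = Ident M (X \<otimes>\<^sub>o Y)"

    and lunit_hom: "X \<in> Obj M \<Longrightarrow> lunit M X \<in> hom M (unit M \<otimes>\<^sub>o X) X"
    and lunit_even: "X \<in> Obj M \<Longrightarrow> grade M (lunit M X) = 0"
    and lunit_iso: "X \<in> Obj M \<Longrightarrow> iso M (lunit M X)"
    and lunit_natural_even: "\<lbrakk>f \<in> hom M X Y; grade M f = 0\<rbrakk>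
      \<Longrightarrow> lunit M Y \<cdot> (Ident M (unit M) \<otimes> f) = f \<cdot> lunit M X"
    and lunit_natural_odd: "\<lbrakk>f \<in> hom M X Y; grade M f = 1\<rbrakk>
      \<Longrightarrow> lunit M Y \<cdot> (unit_star M \<otimes> f) = f \<cdot> lunit M X"

    and pentagon: "\<lbrakk>W \<in> Obj M; X \<in> Obj M; Y \<in> Obj M; Z \<in> Obj M\<rbrakk>
      \<Longrightarrow> assoc M W X (Y \<otimes>\<^sub>o Z) \<cdot> assoc M (W \<otimes>\<^sub>o X) Y Z
        = (Ident M W \<otimes> assoc M X Y Z) \<cdot> assoc M W (X \<otimes>\<^sub>o Y) Z \<cdot> (assoc M W X Y \<otimes> Ident M Z)"
    and triangle: "\<lbrakk>X \<in> Obj M; Y \<in> Obj M\<rbrakk>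
      \<Longrightarrow> (Ident M X \<otimes> lunit M Y) \<cdot> assoc M X (unit M) Y = runit M X \<otimes> Ident M Y"
    and hexagon: "\<lbrakk>X \<in> Obj M; Y \<in> Obj M; Z \<in> Obj M\<rbrakk>
      \<Longrightarrow> assoc M Y Z X \<cdot> symm M X (Y \<otimes>\<^sub>o Z) \<cdot> assoc M X Y Z
        = (Ident M Y \<otimes> symm M X Z) \<cdot> assoc M Y X Z \<cdot> (symm M X Y \<otimes> Ident M Z)"

text \<open>
  \<open>id\<^sub>X \<otimes> c\<^sub>X\<^sub>,\<^sub>Y \<otimes> id\<^sub>Y\<close> with its associators, as a morphism
  from \<open>(X \<otimes> X) \<otimes> (Y \<otimes> Y)\<close> to \<open>(X \<otimes> Y) \<otimes> (X \<otimes> Y)\<close>.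
\<close>

definition middle_swap :: "('o, 'm, 'e) monoidal_data_scheme \<Rightarrow> 'o \<Rightarrow> 'o \<Rightarrow> 'm" where
  "middle_swap M X Y =
     inverse_arrow M (assoc M X Y (X \<otimes>\<^sub>o\<^bsub>M\<^esub> Y))
     \<cdot>\<^bsub>M\<^esub> (Ident M X \<otimes>\<^bsub>M\<^esub> assoc M Y X Y)
     \<cdot>\<^bsub>M\<^esub> (Ident M X \<otimes>\<^bsub>M\<^esub> (symm M X Y \<otimes>\<^bsub>M\<^esub> Ident M Y))
     \<cdot>\<^bsub>M\<^esub> (Ident M X \<otimes>\<^bsub>M\<^esub> inverse_arrow M (assoc M X Y Y))
     \<cdot>\<^bsub>M\<^esub> assoc M X X (Y \<otimes>\<^sub>o\<^bsub>M\<^esub> Y)"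


section \<open>Quantum CD and quantum Markov categories\<close>

record ('o, 'm) quantum_cd_data = "('o, 'm) monoidal_data" +
  copy :: "'o \<Rightarrow> 'm"
  discard :: "'o \<Rightarrow> 'm"
  star :: "'o \<Rightarrow> 'm"

text \<open>
  The associators and unitors that are usually suppressed are inserted explicitly.
  No law identifying \<open>star M (unit M)\<close> with \<open>unit_star M\<close> is needed: it follows from
  \<open>discard_star\<close> and \<open>discard_unit\<close>.
\<close>

locale quantum_cd_category = z2_monoidal_category M
  for M :: "('o, 'm, 'e) quantum_cd_data_scheme" (structure) +
  assumes copy_hom: "X \<in> Obj M \<Longrightarrow> copy M X \<in> hom M X (X \<otimes>\<^sub>o X)"
    and copy_even: "X \<in> Obj M \<Longrightarrow> grade M (copy M X) = 0"
    and discard_hom: "X \<in> Obj M \<Longrightarrow> discard M X \<in> hom M X (unit M)"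
    and discard_even: "X \<in> Obj M \<Longrightarrow> grade M (discard M X) = 0"
    and star_hom: "X \<in> Obj M \<Longrightarrow> star M X \<in> hom M X X"
    and star_odd: "X \<in> Obj M \<Longrightarrow> grade M (star M X) = 1"
    and counit_left: "X \<in> Obj M
      \<Longrightarrow> lunit M X \<cdot> (discard M X \<otimes> Ident M X) \<cdot> copy M X = Ident M X"
    and counit_right: "X \<in> Obj M
      \<Longrightarrow> runit M X \<cdot> (Ident M X \<otimes> discard M X) \<cdot> copy M X = Ident M X"
    and coassoc: "X \<in> Obj M
      \<Longrightarrow> assoc M X X X \<cdot> (copy M X \<otimes> Ident M X) \<cdot> copy M X
        = (Ident M X \<otimes> copy M X) \<cdot> copy M X"
    and copy_star: "X \<in> Obj M
      \<Longrightarrow> symm M X X \<cdot> (star M X \<otimes> star M X) \<cdot> copy M X = copy M X \<cdot> star M X"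
    and discard_tensor: "\<lbrakk>X \<in> Obj M; Y \<in> Obj M\<rbrakk>
      \<Longrightarrow> discard M (X \<otimes>\<^sub>o Y) = lunit M (unit M) \<cdot> (discard M X \<otimes> discard M Y)"
    and discard_unit: "discard M (unit M) = Ident M (unit M)"
    and copy_tensor: "\<lbrakk>X \<in> Obj M; Y \<in> Obj M\<rbrakk>
      \<Longrightarrow> copy M (X \<otimes>\<^sub>o Y) = middle_swap M X Y \<cdot> (copy M X \<otimes> copy M Y)"
    and copy_unit: "copy M (unit M) = inverse_arrow M (lunit M (unit M))"
    and star_star: "X \<in> Obj M \<Longrightarrow> star M X \<cdot> star M X = Ident M X"
    and star_tensor: "\<lbrakk>X \<in> Obj M; Y \<in> Obj M\<rbrakk>
      \<Longrightarrow> star M (X \<otimes>\<^sub>o Y) = star M X \<otimes> star M Y"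
    and discard_star: "X \<in> Obj M \<Longrightarrow> discard M X \<cdot> star M X = unit_star M \<cdot> discard M X"

locale quantum_markov_category = quantum_cd_category M
  for M :: "('o, 'm, 'e) quantum_cd_data_scheme" (structure) +
  assumes discard_natural_even: "\<lbrakk>f \<in> hom M X Y; grade M f = 0\<rbrakk>
      \<Longrightarrow> discard M Y \<cdot> f = discard M X"
    and discard_natural_odd: "\<lbrakk>f \<in> hom M X Y; grade M f = 1\<rbrakk>
      \<Longrightarrow> discard M Y \<cdot> f = discard M X \<cdot> star M X"

definition star_preserving_arrow ::
    "('o, 'm, 'e) quantum_cd_data_scheme \<Rightarrow> 'm \<Rightarrow> bool" where
  "star_preserving_arrow M f \<longleftrightarrow>
     f \<cdot>\<^bsub>M\<^esub> star M (Dom M f) = star M (Cod M f) \<cdot>\<^bsub>M\<^esub> f"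

definition star_preserving ::
    "('o, 'm, 'e) quantum_cd_data_scheme \<Rightarrow> ('o, 'm, 'd) category_data_scheme \<Rightarrow> bool" where
  "star_preserving M C \<longleftrightarrow> (\<forall>f \<in> Arr C. star_preserving_arrow M f)"


section \<open>Bayes maps\<close>

definition states :: "('o, 'm, 'e) monoidal_data_scheme \<Rightarrow> 'o \<Rightarrow> 'm set" where
  "states M X = hom M (unit M) X"

text \<open>
  In the Bayes equations \<open>f\<close> and its Bayes map are tensored with an identity, which is
  defined only for even morphisms; hence the evenness of \<open>f\<close>.
\<close>

definition state_preserving ::
    "('o, 'm, 'e) monoidal_data_scheme \<Rightarrow> 'o \<Rightarrow> 'o \<Rightarrow> 'm \<Rightarrow> 'm \<Rightarrow> 'm \<Rightarrow> bool" where
  "state_preserving M X Y f p q \<longleftrightarrow>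
     p \<in> states M X \<and> q \<in> states M Y \<and> f \<in> hom (even_subcategory M) X Y \<and> f \<cdot>\<^bsub>M\<^esub> p = q"

definition left_bayes_map ::
    "('o, 'm, 'e) quantum_cd_data_scheme \<Rightarrow> 'o \<Rightarrow> 'o \<Rightarrow> 'm \<Rightarrow> 'm \<Rightarrow> 'm \<Rightarrow> 'm \<Rightarrow> bool" where
  "left_bayes_map M X Y f p q g \<longleftrightarrow>
     state_preserving M X Y f p q \<and> g \<in> hom (even_subcategory M) Y X \<and>
     (g \<otimes>\<^bsub>M\<^esub> Ident M Y) \<cdot>\<^bsub>M\<^esub> copy M Y \<cdot>\<^bsub>M\<^esub> q = (Ident M X \<otimes>\<^bsub>M\<^esub> f) \<cdot>\<^bsub>M\<^esub> copy M X \<cdot>\<^bsub>M\<^esub> p"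

definition right_bayes_map ::
    "('o, 'm, 'e) quantum_cd_data_scheme \<Rightarrow> 'o \<Rightarrow> 'o \<Rightarrow> 'm \<Rightarrow> 'm \<Rightarrow> 'm \<Rightarrow> 'm \<Rightarrow> bool" where
  "right_bayes_map M X Y f p q g \<longleftrightarrow>
     state_preserving M X Y f p q \<and> g \<in> hom (even_subcategory M) Y X \<and>
     (Ident M Y \<otimes>\<^bsub>M\<^esub> g) \<cdot>\<^bsub>M\<^esub> copy M Y \<cdot>\<^bsub>M\<^esub> q = (f \<otimes>\<^bsub>M\<^esub> Ident M X) \<cdot>\<^bsub>M\<^esub> copy M X \<cdot>\<^bsub>M\<^esub> p"

definition left_bayesian_inverse ::
    "('o, 'm, 'e) quantum_cd_data_scheme \<Rightarrow> ('o, 'm, 'd) category_data_scheme \<Rightarrow>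
     'o \<Rightarrow> 'o \<Rightarrow> 'm \<Rightarrow> 'm \<Rightarrow> 'm \<Rightarrow> 'm \<Rightarrow> bool" where
  "left_bayesian_inverse M C X Y f p q g \<longleftrightarrow> left_bayes_map M X Y f p q g \<and> g \<in> hom C Y X"

definition right_bayesian_inverse ::
    "('o, 'm, 'e) quantum_cd_data_scheme \<Rightarrow> ('o, 'm, 'd) category_data_scheme \<Rightarrow>
     'o \<Rightarrow> 'o \<Rightarrow> 'm \<Rightarrow> 'm \<Rightarrow> 'm \<Rightarrow> 'm \<Rightarrow> bool" where
  "right_bayesian_inverse M C X Y f p q g \<longleftrightarrow> right_bayes_map M X Y f p q g \<and> g \<in> hom C Y X"

end

theory Submission
  imports Defs
begin

text \<open>
  Bayes maps compose by the interchange law. For the second claim, the left Bayes equation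
  for \<open>f\<close> with Bayes map \<open>g\<close>, read backwards, is the right Bayes equation for \<open>g\<close> with Bayes map
  \<open>f\<close>, and marginalizing either equation gives \<open>g q = p\<close>. For \<open>*\<close>-preserving arrows, left and
  right Bayes equations are exchanged by the flip
  \<open>u \<mapsto> c \<cdot> (* \<otimes> *) \<cdot> u \<cdot> *\<^sub>I\<close>.
\<close>

section \<open>Even morphisms, interchange and the right unitor\<close>

lemma hom_even_subcategory:
  "f \<in> hom (even_subcategory M) X Y \<longleftrightarrow> f \<in> hom M X Y \<and> grade M f = 0"
  by (auto simp: hom_def even_subcategory_def)

lemma (in category) hom_objs:
  assumes "f \<in> hom C X Y"
  shows "X \<in> Obj C" "Y \<in> Obj C"
  using assms dom_obj cod_obj by (auto simp: hom_def)

lemma (in z2_graded_category) even_comp: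
  assumes "f \<in> hom (even_subcategory M) X Y" "g \<in> hom (even_subcategory M) Y Z"
  shows "g \<cdot> f \<in> hom (even_subcategory M) X Z"
  using assms comp_hom grade_comp by (auto simp: hom_even_subcategory)

lemma (in z2_graded_category) even_id:
  "X \<in> Obj M \<Longrightarrow> Ident M X \<in> hom (even_subcategory M) X X"
  using id_hom grade_id by (auto simp: hom_even_subcategory)

context z2_monoidal_category
begin

lemma even_tensor:
  assumes "f \<in> hom (even_subcategory M) X Y" "g \<in> hom (even_subcategory M) X' Y'"
  shows "f \<otimes> g \<in> hom (even_subcategory M) (X \<otimes>\<^sub>o X') (Y \<otimes>\<^sub>o Y')"
  using assms tensor_hom tensor_grade by (auto simp: hom_def even_subcategory_def)

text \<open>The interchange law in the form used throughout: evenness settles the grade side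
  conditions of \<open>tensor_comp\<close>, and the equation is oriented so that tensors
  merge.\<close>

lemma even_tensor_comp:
  assumes "f \<in> hom (even_subcategory M) X Y" "g \<in> hom (even_subcategory M) Y Z"
    and "f' \<in> hom (even_subcategory M) X' Y'" "g' \<in> hom (even_subcategory M) Y' Z'"
  shows "(g \<otimes> g') \<cdot> (f \<otimes> f') = (g \<cdot> f) \<otimes> (g' \<cdot> f')"
  using assms tensor_comp[of f X Y g Z f' X' Y' g' Z'] by (simp add: hom_even_subcategory)

lemma tensor_whisker_left:
  assumes "f \<in> hom (even_subcategory M) X Y" "g \<in> hom (even_subcategory M) Y Z" "W \<in> Obj M"
  shows "(g \<otimes> Ident M W) \<cdot> (f \<otimes> Ident M W) = (g \<cdot> f) \<otimes> Ident M W"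
  using even_tensor_comp[OF assms(1,2) even_id even_id, OF assms(3,3)] assms(3)
  by (simp add: id_left[OF id_hom])

lemma tensor_whisker_right:
  assumes "f \<in> hom (even_subcategory M) X Y" "g \<in> hom (even_subcategory M) Y Z" "W \<in> Obj M"
  shows "(Ident M W \<otimes> g) \<cdot> (Ident M W \<otimes> f) = Ident M W \<otimes> (g \<cdot> f)"
  using even_tensor_comp[OF even_id even_id assms(1,2), OF assms(3,3)] assms(3)
  by (simp add: id_left[OF id_hom])

text \<open>Morphisms acting on different tensor factors commute: pad each with an identity and
  apply interchange. Having both orders available lets a Bayes map on one leg slide past a morphism
  on the other.\<close>

lemma tensor_left_right:
  assumes f: "f \<in> hom (even_subcategory M) X Y" and g: "g \<in> hom (even_subcategory M) X' Y'"
  shows "(f \<otimes> Ident M Y') \<cdot> (Ident M X \<otimes> g) = f \<otimes> g"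
    and "(Ident M Y \<otimes> g) \<cdot> (f \<otimes> Ident M X') = f \<otimes> g"
proof -
  have f': "f \<in> hom M X Y" and g': "g \<in> hom M X' Y'"
    using f g by (auto simp: hom_even_subcategory)
  note f_objs = hom_objs[OF f'] and g_objs = hom_objs[OF g']
  show "(f \<otimes> Ident M Y') \<cdot> (Ident M X \<otimes> g) = f \<otimes> g"
    using even_tensor_comp[OF even_id[OF f_objs(1)] f g even_id[OF g_objs(2)]]
      id_right[OF f'] id_left[OF g'] by simp
  show "(Ident M Y \<otimes> g) \<cdot> (f \<otimes> Ident M X') = f \<otimes> g"
    using even_tensor_comp[OF f even_id[OF f_objs(2)] even_id[OF g_objs(1)] g]
      id_left[OF f'] id_right[OF g'] by simp
qed

lemma runit_hom:
  assumes "X \<in> Obj M"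
  shows "runit M X \<in> hom M (X \<otimes>\<^sub>o unit M) X"
  unfolding runit_def using assms comp_hom[OF sym_hom lunit_hom] unit_obj by blast

text \<open>The right unitor is the symmetry followed by the left unitor, so its naturality is
  inherited from theirs. Only even \<open>f\<close> can occur, since \<open>f\<close> is tensored
  with an identity.\<close>

lemma runit_natural_even:
  assumes f: "f \<in> hom M X Y" and even: "grade M f = 0"
  shows "runit M Y \<cdot> (f \<otimes> Ident M (unit M)) = f \<cdot> runit M X"
proof -
  let ?I = "Ident M (unit M)"
  note objs = hom_objs[OF f] and unit = unit_obj
  have id: "?I \<in> hom M (unit M) (unit M)" "grade M ?I = 0"
    using unit id_hom grade_id by auto
  have fI: "f \<otimes> ?I \<in> hom M (X \<otimes>\<^sub>o unit M) (Y \<otimes>\<^sub>o unit M)"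
    and If: "?I \<otimes> f \<in> hom M (unit M \<otimes>\<^sub>o X) (unit M \<otimes>\<^sub>o Y)"
    using tensor_hom f id even by auto
  have "runit M Y \<cdot> (f \<otimes> ?I) = lunit M Y \<cdot> (symm M Y (unit M) \<cdot> (f \<otimes> ?I))"
    unfolding runit_def
    by (rule comp_assoc[OF fI sym_hom[OF objs(2) unit] lunit_hom[OF objs(2)]])
  also have "\<dots> = lunit M Y \<cdot> ((?I \<otimes> f) \<cdot> symm M X (unit M))"
    using sym_natural[OF f id(1)] id even by simp
  also have "\<dots> = lunit M Y \<cdot> (?I \<otimes> f) \<cdot> symm M X (unit M)"
    by (rule comp_assoc[OF sym_hom[OF objs(1) unit] If lunit_hom[OF objs(2)], symmetric])
  also have "\<dots> = f \<cdot> lunit M X \<cdot> symm M X (unit M)"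
    using lunit_natural_even[OF f even] by simp
  also have "\<dots> = f \<cdot> runit M X"
    unfolding runit_def
    by (rule comp_assoc[OF sym_hom[OF objs(1) unit] lunit_hom[OF objs(1)] f])
  finally show ?thesis .
qed

end

section \<open>Typing and rebracketing of copied arrows\<close>

lemma (in quantum_cd_category) copy_state_hom:
  assumes "p \<in> hom M W X"
  shows "copy M X \<cdot> p \<in> hom M W (X \<otimes>\<^sub>o X)"
  using comp_hom[OF assms copy_hom] hom_objs[OF assms] by auto

text \<open>Composition associates to the left, so each side of a Bayes equation reads
  \<open>((h \<otimes> k) \<cdot> copy M X) \<cdot> p\<close>. This regroups it so that
  \<open>copy M X \<cdot> p\<close> can be treated as one morphism into which further tensors are
  absorbed.\<close>

lemma (in quantum_cd_category) tensor_copy_assoc: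
  assumes p: "p \<in> hom M W X"
    and h: "h \<in> hom (even_subcategory M) X A" and k: "k \<in> hom (even_subcategory M) X B"
  shows "(h \<otimes> k) \<cdot> copy M X \<cdot> p = (h \<otimes> k) \<cdot> (copy M X \<cdot> p)"
  using comp_assoc[OF p copy_hom] even_tensor[OF h k] hom_objs[OF p]
  by (auto simp: hom_even_subcategory)

section \<open>Marginals\<close>

context quantum_markov_category
begin

text \<open>Discarding the second leg absorbs \<open>k\<close> because \<open>k\<close> is even;
  naturality of the right unitor then moves \<open>h\<close> outside, and the counit law removes the
  copy.\<close>

lemma marginal_left:
  assumes p: "p \<in> hom M W X"
    and h: "h \<in> hom (even_subcategory M) X A" and k: "k \<in> hom (even_subcategory M) X B"
  shows "runit M A \<cdot> ((Ident M A \<otimes> discard M B) \<cdot> ((h \<otimes> k) \<cdot> copy M X \<cdot> p)) = h \<cdot> p"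
proof -
  let ?I = "Ident M (unit M)" and ?D = "Ident M X \<otimes> discard M X"
  have h': "h \<in> hom M X A" "grade M h = 0" and k': "k \<in> hom M X B" "grade M k = 0"
    using h k by (auto simp: hom_even_subcategory)
  have objs: "X \<in> Obj M" "A \<in> Obj M" "B \<in> Obj M" "unit M \<in> Obj M"
    using hom_objs[OF h'(1)] hom_objs[OF k'(1)] unit_obj by auto
  have dis: "discard M V \<in> hom (even_subcategory M) V (unit M)" if "V \<in> Obj M" for V
    using that discard_hom discard_even by (simp add: hom_even_subcategory)
  note cp = copy_state_hom[OF p]
  have hom: "h \<otimes> k \<in> hom M (X \<otimes>\<^sub>o X) (A \<otimes>\<^sub>o B)"
    "Ident M A \<otimes> discard M B \<in> hom M (A \<otimes>\<^sub>o B) (A \<otimes>\<^sub>o unit M)"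
    "h \<otimes> ?I \<in> hom M (X \<otimes>\<^sub>o unit M) (A \<otimes>\<^sub>o unit M)"
    "?D \<in> hom M (X \<otimes>\<^sub>o X) (X \<otimes>\<^sub>o unit M)"
    using even_tensor[OF h k] even_tensor[OF even_id dis] even_tensor[OF h even_id] objs
    by (auto simp: hom_even_subcategory)
  have Dc: "?D \<cdot> (copy M X \<cdot> p) \<in> hom M W (X \<otimes>\<^sub>o unit M)"
    by (rule comp_hom[OF cp hom(4)])
  \<comment> \<open>The Markov axiom enters here, as
    \<open>discard M B \<cdot> k = discard M X\<close>.\<close>
  have "(Ident M A \<otimes> discard M B) \<cdot> (h \<otimes> k) = h \<otimes> discard M X"
    using even_tensor_comp[OF h even_id k dis] objs id_left[OF h'(1)]
      discard_natural_even[OF k'] by simp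
  also have "\<dots> = (h \<otimes> ?I) \<cdot> ?D"
    using tensor_left_right(1)[OF h dis] objs by simp
  finally have slide: "(Ident M A \<otimes> discard M B) \<cdot> (h \<otimes> k) = (h \<otimes> ?I) \<cdot> ?D" .
  have "(Ident M A \<otimes> discard M B) \<cdot> ((h \<otimes> k) \<cdot> copy M X \<cdot> p)
      = (h \<otimes> ?I) \<cdot> (?D \<cdot> (copy M X \<cdot> p))"
    unfolding tensor_copy_assoc[OF p h k]
    using comp_assoc[OF cp hom(1,2)] comp_assoc[OF cp hom(4,3)] slide by simp
  then have "runit M A \<cdot> ((Ident M A \<otimes> discard M B) \<cdot> ((h \<otimes> k) \<cdot> copy M X \<cdot> p))
      = (runit M A \<cdot> (h \<otimes> ?I)) \<cdot> (?D \<cdot> (copy M X \<cdot> p))"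
    using comp_assoc[OF Dc hom(3) runit_hom[OF objs(2)]] by simp
  also have "\<dots> = h \<cdot> (runit M X \<cdot> (?D \<cdot> (copy M X \<cdot> p)))"
    unfolding runit_natural_even[OF h'] by (rule comp_assoc[OF Dc runit_hom[OF objs(1)] h'(1)])
  \<comment> \<open>Rebracketing isolates the left-hand side of \<open>counit_right\<close>.\<close>
  also have "runit M X \<cdot> (?D \<cdot> (copy M X \<cdot> p)) = (runit M X \<cdot> ?D \<cdot> copy M X) \<cdot> p"
    using comp_assoc[OF cp hom(4) runit_hom[OF objs(1)]]
      comp_assoc[OF p copy_hom[OF objs(1)] comp_hom[OF hom(4) runit_hom[OF objs(1)]]] by simp
  also have "\<dots> = p"
    using counit_right objs(1) id_left[OF p] by simp
  finally show ?thesis .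
qed

text \<open>The mirror image of \<open>marginal_left\<close>: \<open>h\<close> is absorbed by the
  discard, and the left unitor and the left counit law replace the right ones.\<close>

lemma marginal_right:
  assumes p: "p \<in> hom M W X"
    and h: "h \<in> hom (even_subcategory M) X A" and k: "k \<in> hom (even_subcategory M) X B"
  shows "lunit M B \<cdot> ((discard M A \<otimes> Ident M B) \<cdot> ((h \<otimes> k) \<cdot> copy M X \<cdot> p)) = k \<cdot> p"
proof -
  let ?I = "Ident M (unit M)" and ?D = "discard M X \<otimes> Ident M X"
  have h': "h \<in> hom M X A" "grade M h = 0" and k': "k \<in> hom M X B" "grade M k = 0"
    using h k by (auto simp: hom_even_subcategory)
  have objs: "X \<in> Obj M" "A \<in> Obj M" "B \<in> Obj M" "unit M \<in> Obj M"
    using hom_objs[OF h'(1)] hom_objs[OF k'(1)] unit_obj by auto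
  have dis: "discard M V \<in> hom (even_subcategory M) V (unit M)" if "V \<in> Obj M" for V
    using that discard_hom discard_even by (simp add: hom_even_subcategory)
  note cp = copy_state_hom[OF p]
  have hom: "h \<otimes> k \<in> hom M (X \<otimes>\<^sub>o X) (A \<otimes>\<^sub>o B)"
    "discard M A \<otimes> Ident M B \<in> hom M (A \<otimes>\<^sub>o B) (unit M \<otimes>\<^sub>o B)"
    "?I \<otimes> k \<in> hom M (unit M \<otimes>\<^sub>o X) (unit M \<otimes>\<^sub>o B)"
    "?D \<in> hom M (X \<otimes>\<^sub>o X) (unit M \<otimes>\<^sub>o X)"
    using even_tensor[OF h k] even_tensor[OF dis even_id] even_tensor[OF even_id k] objs
    by (auto simp: hom_even_subcategory)
  have Dc: "?D \<cdot> (copy M X \<cdot> p) \<in> hom M W (unit M \<otimes>\<^sub>o X)"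
    by (rule comp_hom[OF cp hom(4)])
  have "(discard M A \<otimes> Ident M B) \<cdot> (h \<otimes> k) = discard M X \<otimes> k"
    using even_tensor_comp[OF h dis k even_id] objs id_left[OF k'(1)]
      discard_natural_even[OF h'] by simp
  also have "\<dots> = (?I \<otimes> k) \<cdot> ?D"
    using tensor_left_right(2)[OF dis k] objs by simp
  finally have slide: "(discard M A \<otimes> Ident M B) \<cdot> (h \<otimes> k) = (?I \<otimes> k) \<cdot> ?D" .
  have "(discard M A \<otimes> Ident M B) \<cdot> ((h \<otimes> k) \<cdot> copy M X \<cdot> p)
      = (?I \<otimes> k) \<cdot> (?D \<cdot> (copy M X \<cdot> p))"
    unfolding tensor_copy_assoc[OF p h k]
    using comp_assoc[OF cp hom(1,2)] comp_assoc[OF cp hom(4,3)] slide by simp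
  then have "lunit M B \<cdot> ((discard M A \<otimes> Ident M B) \<cdot> ((h \<otimes> k) \<cdot> copy M X \<cdot> p))
      = (lunit M B \<cdot> (?I \<otimes> k)) \<cdot> (?D \<cdot> (copy M X \<cdot> p))"
    using comp_assoc[OF Dc hom(3) lunit_hom[OF objs(3)]] by simp
  also have "\<dots> = k \<cdot> (lunit M X \<cdot> (?D \<cdot> (copy M X \<cdot> p)))"
    unfolding lunit_natural_even[OF k'] by (rule comp_assoc[OF Dc lunit_hom[OF objs(1)] k'(1)])
  also have "lunit M X \<cdot> (?D \<cdot> (copy M X \<cdot> p)) = (lunit M X \<cdot> ?D \<cdot> copy M X) \<cdot> p"
    using comp_assoc[OF cp hom(4) lunit_hom[OF objs(1)]]
      comp_assoc[OF p copy_hom[OF objs(1)] comp_hom[OF hom(4) lunit_hom[OF objs(1)]]] by simp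
  also have "\<dots> = p"
    using counit_left objs(1) id_left[OF p] by simp
  finally show ?thesis .
qed

end

section \<open>The star flip and the two kinds of Bayes equation\<close>

context quantum_cd_category
begin

lemma star_preserving_Ident: "X \<in> Obj M \<Longrightarrow> star_preserving_arrow M (Ident M X)"
  using id_hom[of X] id_left[OF star_hom] id_right[OF star_hom]
  by (auto simp: star_preserving_arrow_def hom_def)

lemma star_preserving_hom:
  "f \<in> hom M X Y \<Longrightarrow> star_preserving_arrow M f \<longleftrightarrow> f \<cdot> star M X = star M Y \<cdot> f"
  by (auto simp: star_preserving_arrow_def hom_def)

text \<open>The flip exchanges the two legs of a copied star-preserving arrow. The outer stars pass
  through \<open>h\<close> and \<open>k\<close>, the symmetry swaps these by naturality, and what
  reaches the copy is the left-hand side of \<open>copy_star\<close>. The star this emits cancels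
  the one at the source.\<close>

lemma flip_star_tensor_copy:
  assumes p: "p \<in> hom M W X" "star_preserving_arrow M p"
    and h: "h \<in> hom (even_subcategory M) X A" "star_preserving_arrow M h"
    and k: "k \<in> hom (even_subcategory M) X B" "star_preserving_arrow M k"
  shows "symm M A B \<cdot> ((star M A \<otimes> star M B) \<cdot> ((h \<otimes> k) \<cdot> copy M X \<cdot> p \<cdot> star M W))
    = (k \<otimes> h) \<cdot> copy M X \<cdot> p"
proof -
  let ?S = "\<lambda>V. star M V"
  have h': "h \<in> hom M X A" "grade M h = 0" and k': "k \<in> hom M X B" "grade M k = 0"
    using h k by (auto simp: hom_even_subcategory)
  have objs: "W \<in> Obj M" "X \<in> Obj M" "A \<in> Obj M" "B \<in> Obj M"
    using hom_objs[OF p(1)] hom_objs[OF h'(1)] hom_objs[OF k'(1)] by auto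
  note st = star_hom[OF objs(2)] star_hom[OF objs(3)] star_hom[OF objs(4)]
  note gr = star_odd[OF objs(2)] star_odd[OF objs(3)] star_odd[OF objs(4)] h'(2) k'(2)
  have SX: "?S X \<otimes> ?S X \<in> hom M (X \<otimes>\<^sub>o X) (X \<otimes>\<^sub>o X)"
    and SAB: "?S A \<otimes> ?S B \<in> hom M (A \<otimes>\<^sub>o B) (A \<otimes>\<^sub>o B)"
    and hk: "h \<otimes> k \<in> hom M (X \<otimes>\<^sub>o X) (A \<otimes>\<^sub>o B)"
    and kh: "k \<otimes> h \<in> hom M (X \<otimes>\<^sub>o X) (B \<otimes>\<^sub>o A)"
    using tensor_hom st h'(1) k'(1) gr by auto
  note symX = sym_hom[OF objs(2,2)] and symAB = sym_hom[OF objs(3,4)]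
  note copyX = copy_hom[OF objs(2)]
  \<comment> \<open>As \<open>p\<close> preserves stars, \<open>u\<close> is also
    \<open>?S X \<cdot> p\<close>; hence a second star on \<open>X\<close> gives back
    \<open>p\<close>.\<close>
  define u where "u = p \<cdot> ?S W"
  have u: "u \<in> hom M W X" and Su: "?S X \<cdot> u = p"
  proof -
    have u_eq: "u = ?S X \<cdot> p"
      using p star_preserving_hom by (simp add: u_def)
    show "u \<in> hom M W X"
      unfolding u_eq by (rule comp_hom[OF p(1) st(1)])
    show "?S X \<cdot> u = p"
      unfolding u_eq using comp_assoc[OF p(1) st(1) st(1)] star_star[OF objs(2)] id_left[OF p(1)]
      by simp
  qed
  note cu = copy_state_hom[OF u]
  \<comment> \<open>Interchange applies on both sides because each tensor pairs equal grades: star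
    with star, both odd, and \<open>h\<close> with \<open>k\<close>, both even.\<close>
  have stars: "(?S A \<otimes> ?S B) \<cdot> (h \<otimes> k) = (h \<otimes> k) \<cdot> (?S X \<otimes> ?S X)"
    using tensor_comp[OF h'(1) st(2) k'(1) st(3)] tensor_comp[OF st(1) h'(1) st(1) k'(1)] gr
      h(2) k(2) star_preserving_hom[OF h'(1)] star_preserving_hom[OF k'(1)] by simp
  have "(h \<otimes> k) \<cdot> copy M X \<cdot> p \<cdot> ?S W = (h \<otimes> k) \<cdot> (copy M X \<cdot> u)"
    using comp_assoc[OF star_hom[OF objs(1)] p(1) comp_hom[OF copyX hk]]
      comp_assoc[OF u copyX hk] by (simp add: u_def)
  then have "(?S A \<otimes> ?S B) \<cdot> ((h \<otimes> k) \<cdot> copy M X \<cdot> p \<cdot> ?S W)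
      = (h \<otimes> k) \<cdot> ((?S X \<otimes> ?S X) \<cdot> (copy M X \<cdot> u))"
    using comp_assoc[OF cu hk SAB] comp_assoc[OF cu SX hk] stars by simp
  then have "symm M A B \<cdot> ((?S A \<otimes> ?S B) \<cdot> ((h \<otimes> k) \<cdot> copy M X \<cdot> p \<cdot> ?S W))
      = symm M A B \<cdot> (h \<otimes> k) \<cdot> ((?S X \<otimes> ?S X) \<cdot> (copy M X \<cdot> u))"
    using comp_assoc[OF comp_hom[OF cu SX] hk symAB] by simp
  also have "\<dots> = (k \<otimes> h) \<cdot> (symm M X X \<cdot> ((?S X \<otimes> ?S X) \<cdot> (copy M X \<cdot> u)))"
    using sym_natural[OF h'(1) k'(1)] gr comp_assoc[OF comp_hom[OF cu SX] symX kh] by simp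
  also have "symm M X X \<cdot> ((?S X \<otimes> ?S X) \<cdot> (copy M X \<cdot> u))
      = (symm M X X \<cdot> (?S X \<otimes> ?S X) \<cdot> copy M X) \<cdot> u"
    using comp_assoc[OF cu SX symX] comp_assoc[OF u copyX comp_hom[OF SX symX]] by simp
  \<comment> \<open>By \<open>copy_star\<close> the bracket is \<open>copy M X \<cdot> ?S X\<close>,
    and \<open>?S X \<cdot> u = p\<close>.\<close>
  also have "\<dots> = copy M X \<cdot> p"
    using copy_star[OF objs(2)] comp_assoc[OF u st(1) copyX] Su by simp
  also have "(k \<otimes> h) \<cdot> (copy M X \<cdot> p) = (k \<otimes> h) \<cdot> copy M X \<cdot> p"
    by (rule comp_assoc[OF p(1) copyX kh, symmetric])
  finally show ?thesis .
qed

text \<open>Both sides of a Bayes equation are copied states with star-preserving legs and a common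
  target, so flipping both sides of one equation yields the other.\<close>

lemma left_bayes_iff_right_bayes:
  assumes star: "star_preserving_arrow M f" "star_preserving_arrow M g"
      "star_preserving_arrow M p" "star_preserving_arrow M q"
  shows "left_bayes_map M X Y f p q g \<longleftrightarrow> right_bayes_map M X Y f p q g"
\<comment> \<open>These typing conditions are common to both definitions; where they fail, both
  sides are false.\<close>
proof (cases "state_preserving M X Y f p q \<and> g \<in> hom (even_subcategory M) Y X")
  case True
  then have p: "p \<in> hom M (unit M) X" and q: "q \<in> hom M (unit M) Y"
    and f: "f \<in> hom (even_subcategory M) X Y" and g: "g \<in> hom (even_subcategory M) Y X"
    by (auto simp: state_preserving_def states_def)
  have objs: "X \<in> Obj M" "Y \<in> Obj M"
    using hom_objs[OF p] hom_objs[OF q] by auto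
  note id = even_id[OF objs(1)] even_id[OF objs(2)]
    and id_star = star_preserving_Ident[OF objs(1)] star_preserving_Ident[OF objs(2)]
  note flip_p = flip_star_tensor_copy[OF p star(3)] and flip_q = flip_star_tensor_copy[OF q star(4)]
  have "(g \<otimes> Ident M Y) \<cdot> copy M Y \<cdot> q = (Ident M X \<otimes> f) \<cdot> copy M X \<cdot> p \<longleftrightarrow>
      (Ident M Y \<otimes> g) \<cdot> copy M Y \<cdot> q = (f \<otimes> Ident M X) \<cdot> copy M X \<cdot> p"
    \<comment> \<open>Four flips: each side of the left equation and each side of the right one,
      giving the two implications.\<close>
    using flip_q[OF g star(2) id(2) id_star(2)] flip_q[OF id(2) id_star(2) g star(2)]
      flip_p[OF f star(1) id(1) id_star(1)] flip_p[OF id(1) id_star(1) f star(1)] by metis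
  then show ?thesis
    unfolding left_bayes_map_def right_bayes_map_def by blast
qed (auto simp: left_bayes_map_def right_bayes_map_def)

section \<open>Composition of Bayes maps\<close>

lemma state_preserving_comp:
  assumes "state_preserving M X Y f p q" "state_preserving M Y Z g q r"
  shows "state_preserving M X Z (g \<cdot> f) p r"
  using assms even_comp[of f X Y g Z] comp_assoc[of p "unit M" X f Y g Z]
  by (auto simp: state_preserving_def states_def hom_even_subcategory)

text \<open>The equation for \<open>g'\<close> trades it for \<open>g\<close> on the other leg;
  \<open>f'\<close> slides past \<open>g\<close>; the equation for \<open>f'\<close> then trades it
  for \<open>f\<close>, which joins \<open>g\<close> on the second leg.\<close>

lemma left_bayes_map_comp:
  assumes F: "left_bayes_map M X Y f p q f'" and G: "left_bayes_map M Y Z g q r g'"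
  shows "left_bayes_map M X Z (g \<cdot> f) p r (f' \<cdot> g')"
proof -
  have p: "p \<in> hom M (unit M) X" and q: "q \<in> hom M (unit M) Y" and r: "r \<in> hom M (unit M) Z"
    and f: "f \<in> hom (even_subcategory M) X Y" and g: "g \<in> hom (even_subcategory M) Y Z"
    and f': "f' \<in> hom (even_subcategory M) Y X" and g': "g' \<in> hom (even_subcategory M) Z Y"
    using F G by (auto simp: left_bayes_map_def state_preserving_def states_def)
  have objs: "X \<in> Obj M" "Y \<in> Obj M" "Z \<in> Obj M"
    using hom_objs[OF p] hom_objs[OF q] hom_objs[OF r] by auto
  note id = even_id[OF objs(1)] even_id[OF objs(2)] even_id[OF objs(3)]
  note cp = copy_state_hom[OF p] and cq = copy_state_hom[OF q] and cr = copy_state_hom[OF r]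
  \<comment> \<open>Typing of a tensor of even morphisms in \<open>M\<close> itself, as
    \<open>comp_assoc\<close> requires.\<close>
  note tensor_hom' = even_tensor[THEN hom_even_subcategory[THEN iffD1], THEN conjunct1]
  have Feq: "(f' \<otimes> Ident M Y) \<cdot> (copy M Y \<cdot> q) = (Ident M X \<otimes> f) \<cdot> (copy M X \<cdot> p)"
    using F tensor_copy_assoc[OF q f' id(2)] tensor_copy_assoc[OF p id(1) f]
    by (simp add: left_bayes_map_def)
  have Geq: "(g' \<otimes> Ident M Z) \<cdot> (copy M Z \<cdot> r) = (Ident M Y \<otimes> g) \<cdot> (copy M Y \<cdot> q)"
    using G tensor_copy_assoc[OF r g' id(3)] tensor_copy_assoc[OF q id(2) g]
    by (simp add: left_bayes_map_def)
  have "((f' \<cdot> g') \<otimes> Ident M Z) \<cdot> copy M Z \<cdot> r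
      = (f' \<otimes> Ident M Z) \<cdot> ((g' \<otimes> Ident M Z) \<cdot> (copy M Z \<cdot> r))"
    using tensor_copy_assoc[OF r even_comp[OF g' f'] id(3)] tensor_whisker_left[OF g' f' objs(3)]
      comp_assoc[OF cr tensor_hom'[OF g' id(3)] tensor_hom'[OF f' id(3)]] by simp
  \<comment> \<open>After \<open>Geq\<close>, the factors with \<open>f'\<close> and
    \<open>g\<close> act on different legs, so both orders equal
    \<open>f' \<otimes> g\<close>.\<close>
  also have "\<dots> = (Ident M X \<otimes> g) \<cdot> ((f' \<otimes> Ident M Y) \<cdot> (copy M Y \<cdot> q))"
    unfolding Geq using tensor_left_right[OF f' g]
      comp_assoc[OF cq tensor_hom'[OF id(2) g] tensor_hom'[OF f' id(3)]]
      comp_assoc[OF cq tensor_hom'[OF f' id(2)] tensor_hom'[OF id(1) g]] by simp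
  also have "\<dots> = (Ident M X \<otimes> (g \<cdot> f)) \<cdot> copy M X \<cdot> p"
    unfolding Feq
    using tensor_copy_assoc[OF p id(1) even_comp[OF f g]] tensor_whisker_right[OF f g objs(1)]
      comp_assoc[OF cp tensor_hom'[OF id(1) f] tensor_hom'[OF id(1) g]] by simp
  finally show ?thesis
    using F G state_preserving_comp even_comp[OF g' f'] by (auto simp: left_bayes_map_def)
qed

text \<open>The same argument with the two legs interchanged.\<close>

lemma right_bayes_map_comp:
  assumes F: "right_bayes_map M X Y f p q f'" and G: "right_bayes_map M Y Z g q r g'"
  shows "right_bayes_map M X Z (g \<cdot> f) p r (f' \<cdot> g')"
proof -
  have p: "p \<in> hom M (unit M) X" and q: "q \<in> hom M (unit M) Y" and r: "r \<in> hom M (unit M) Z"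
    and f: "f \<in> hom (even_subcategory M) X Y" and g: "g \<in> hom (even_subcategory M) Y Z"
    and f': "f' \<in> hom (even_subcategory M) Y X" and g': "g' \<in> hom (even_subcategory M) Z Y"
    using F G by (auto simp: right_bayes_map_def state_preserving_def states_def)
  have objs: "X \<in> Obj M" "Y \<in> Obj M" "Z \<in> Obj M"
    using hom_objs[OF p] hom_objs[OF q] hom_objs[OF r] by auto
  note id = even_id[OF objs(1)] even_id[OF objs(2)] even_id[OF objs(3)]
  note cp = copy_state_hom[OF p] and cq = copy_state_hom[OF q] and cr = copy_state_hom[OF r]
  note tensor_hom' = even_tensor[THEN hom_even_subcategory[THEN iffD1], THEN conjunct1]
  have Feq: "(Ident M Y \<otimes> f') \<cdot> (copy M Y \<cdot> q) = (f \<otimes> Ident M X) \<cdot> (copy M X \<cdot> p)"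
    using F tensor_copy_assoc[OF q id(2) f'] tensor_copy_assoc[OF p f id(1)]
    by (simp add: right_bayes_map_def)
  have Geq: "(Ident M Z \<otimes> g') \<cdot> (copy M Z \<cdot> r) = (g \<otimes> Ident M Y) \<cdot> (copy M Y \<cdot> q)"
    using G tensor_copy_assoc[OF r id(3) g'] tensor_copy_assoc[OF q g id(2)]
    by (simp add: right_bayes_map_def)
  have "(Ident M Z \<otimes> (f' \<cdot> g')) \<cdot> copy M Z \<cdot> r
      = (Ident M Z \<otimes> f') \<cdot> ((Ident M Z \<otimes> g') \<cdot> (copy M Z \<cdot> r))"
    using tensor_copy_assoc[OF r id(3) even_comp[OF g' f']] tensor_whisker_right[OF g' f' objs(3)]
      comp_assoc[OF cr tensor_hom'[OF id(3) g'] tensor_hom'[OF id(3) f']] by simp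
  also have "\<dots> = (g \<otimes> Ident M X) \<cdot> ((Ident M Y \<otimes> f') \<cdot> (copy M Y \<cdot> q))"
    unfolding Geq using tensor_left_right[OF g f']
      comp_assoc[OF cq tensor_hom'[OF g id(2)] tensor_hom'[OF id(3) f']]
      comp_assoc[OF cq tensor_hom'[OF id(2) f'] tensor_hom'[OF g id(1)]] by simp
  also have "\<dots> = ((g \<cdot> f) \<otimes> Ident M X) \<cdot> copy M X \<cdot> p"
    unfolding Feq
    using tensor_copy_assoc[OF p even_comp[OF f g] id(1)] tensor_whisker_left[OF f g objs(1)]
      comp_assoc[OF cp tensor_hom'[OF f id(1)] tensor_hom'[OF g id(1)]] by simp
  finally show ?thesis
    using F G state_preserving_comp even_comp[OF g' f'] by (auto simp: right_bayes_map_def)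
qed

end

section \<open>Symmetry of Bayes maps\<close>

context quantum_markov_category
begin

lemma left_bayes_map_symmetric:
  assumes "left_bayes_map M X Y f p q g"
  shows "right_bayes_map M Y X g q p f"
proof -
  have p: "p \<in> hom M (unit M) X" and q: "q \<in> hom M (unit M) Y"
    and f: "f \<in> hom (even_subcategory M) X Y" and g: "g \<in> hom (even_subcategory M) Y X"
    and eq: "(g \<otimes> Ident M Y) \<cdot> copy M Y \<cdot> q = (Ident M X \<otimes> f) \<cdot> copy M X \<cdot> p"
    using assms by (auto simp: left_bayes_map_def state_preserving_def states_def)
  have objs: "X \<in> Obj M" "Y \<in> Obj M"
    using hom_objs[OF p] hom_objs[OF q] by auto
  \<comment> \<open>State preservation of \<open>g\<close> is all that remains beyond reversing
    \<open>eq\<close>. Discarding the \<open>Y\<close> leg of \<open>eq\<close> leaves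
    \<open>g \<cdot> q\<close> on the left and \<open>p\<close> on the right.\<close>
  have "g \<cdot> q = p"
    using marginal_left[OF q g even_id[OF objs(2)]] marginal_left[OF p even_id[OF objs(1)] f]
      id_left[OF p] eq by simp
  then show ?thesis
    using p q f g eq by (simp add: right_bayes_map_def state_preserving_def states_def)
qed

lemma right_bayes_map_symmetric:
  assumes "right_bayes_map M X Y f p q g"
  shows "left_bayes_map M Y X g q p f"
proof -
  have p: "p \<in> hom M (unit M) X" and q: "q \<in> hom M (unit M) Y"
    and f: "f \<in> hom (even_subcategory M) X Y" and g: "g \<in> hom (even_subcategory M) Y X"
    and eq: "(Ident M Y \<otimes> g) \<cdot> copy M Y \<cdot> q = (f \<otimes> Ident M X) \<cdot> copy M X \<cdot> p"
    using assms by (auto simp: right_bayes_map_def state_preserving_def states_def)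
  have objs: "X \<in> Obj M" "Y \<in> Obj M"
    using hom_objs[OF p] hom_objs[OF q] by auto
  \<comment> \<open>Here \<open>Y\<close> is the first leg, hence the other marginal.\<close>
  have "g \<cdot> q = p"
    using marginal_right[OF q even_id[OF objs(2)] g] marginal_right[OF p f even_id[OF objs(1)]]
      id_left[OF p] eq by simp
  then show ?thesis
    using p q f g eq by (simp add: left_bayes_map_def state_preserving_def states_def)
qed

text \<open>Reversing a Bayes equation switches its side; star preservation then supplies the other
  side as well. Taking either kind as hypothesis and yielding both expresses the statement without
  the adjective left or right.\<close>

lemma bayesian_inverse_symmetric:
  assumes "star_preserving M C" and p: "p \<in> Arr C" and q: "q \<in> Arr C" and f: "f \<in> hom C X Y"
    and inv: "left_bayesian_inverse M C X Y f p q g \<or> right_bayesian_inverse M C X Y f p q g"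
  shows "left_bayesian_inverse M C Y X g q p f \<and> right_bayesian_inverse M C Y X g q p f"
proof -
  have "g \<in> Arr C" "f \<in> Arr C"
    using inv f by (auto simp: left_bayesian_inverse_def right_bayesian_inverse_def hom_def)
  \<comment> \<open>The order suits the reversed data: the triple \<open>(g, q, p)\<close> with
    Bayes map \<open>f\<close>.\<close>
  then have star: "star_preserving_arrow M g" "star_preserving_arrow M f"
      "star_preserving_arrow M q" "star_preserving_arrow M p"
    using assms by (auto simp: star_preserving_def)
  have "left_bayes_map M Y X g q p f \<or> right_bayes_map M Y X g q p f"
    using inv left_bayes_map_symmetric right_bayes_map_symmetric
    by (auto simp: left_bayesian_inverse_def right_bayesian_inverse_def)
  then show ?thesis
    using left_bayes_iff_right_bayes[OF star] f
    by (auto simp: left_bayesian_inverse_def right_bayesian_inverse_def)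
qed

end

theorem proposition7p21:
  fixes M :: "('o, 'm) quantum_cd_data"
    and C :: "('o, 'm) category_data"
    and X Y Z :: 'o
    and p q r f g :: 'm
  assumes "quantum_markov_category M"
    and "subcategory C (even_subcategory M)"
    and "p \<in> hom C (unit M) X"
    and "q \<in> hom C (unit M) Y"
    and "r \<in> hom C (unit M) Z"
    and "f \<in> hom C X Y"
    and "g \<in> hom C Y Z"
    and "q = f \<cdot>\<^bsub>M\<^esub> p"
    and "r = g \<cdot>\<^bsub>M\<^esub> q"
  shows "(\<forall>f' g'. left_bayes_map M X Y f p q f' \<and> left_bayes_map M Y Z g q r g'
            \<longrightarrow> left_bayes_map M X Z (g \<cdot>\<^bsub>M\<^esub> f) p r (f' \<cdot>\<^bsub>M\<^esub> g'))
       \<and> (\<forall>f' g'. right_bayes_map M X Y f p q f' \<and> right_bayes_map M Y Z g q r g'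
            \<longrightarrow> right_bayes_map M X Z (g \<cdot>\<^bsub>M\<^esub> f) p r (f' \<cdot>\<^bsub>M\<^esub> g'))
       \<and> (star_preserving M C \<longrightarrow>
           (\<forall>f'. left_bayesian_inverse M C X Y f p q f' \<or> right_bayesian_inverse M C X Y f p q f'
            \<longrightarrow> left_bayesian_inverse M C Y X f' q p f \<and> right_bayesian_inverse M C Y X f' q p f))"
proof -
  interpret quantum_markov_category M by fact
  have "p \<in> Arr C" "q \<in> Arr C"
    using assms by (auto simp: hom_def)
  \<comment> \<open>The open premise is star preservation of \<open>C\<close>, available only inside
    the last claim.\<close>
  note symmetric = bayesian_inverse_symmetric[OF _ this \<open>f \<in> hom C X Y\<close>]
  show ?thesis
    by (intro conjI allI impI; (elim conjE)?)
      (blast intro: left_bayes_map_comp right_bayes_map_comp dest: symmetric)+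
qed

end
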